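(* \[\sum_{k=0}^{\infty}\left(\frac{1}{64}\right)^k\frac{(1)_k^3}{(\frac{3}{2})_k^3}\left\{(21k+13)\Big[H_{2k+1}^{(3)}+2H_{k}^{(3)}\Big]-\frac{27}{8(k+1)^2}\right\}=4\pi^2\zeta(3)-36\zeta(5).\]
   Context: For a number $x$ and a nonnegative integer $m$, the shifted factorial is $(x)_0=1$ and $(x)_m=x(x+1)\cdots(x+m-1)$ for $m\ge 1$; $(x)_k^3$ means $((x)_k)^3$. For $\ell\in\mathbb{Z}^{+}$ and an integer $n\ge 0$, the harmonic number of order $\ell$ is $H_n^{(\ell)}=\sum_{k=1}^n \frac{1}{k^{\ell}}$ (so $H_0^{(\ell)}=0$). $\zeta(s)=\sum_{k=1}^\infty k^{-s}$ is the Riemann zeta function for $\Re(s)>1$. *)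

theory Defs
  imports "HOL-Analysis.Analysis"
begin

text \<open>The order-1 case is \<^const>\<open>harm\<close>.\<close>
definition gen_harm :: "nat \<Rightarrow> nat \<Rightarrow> real" where
  "gen_harm l n = (\<Sum>k=1..n. 1 / real k ^ l)"

text \<open>The series is indexed from 0, hence the shift. The value is meaningful only
  for \<open>Re s > 1\<close>; no analytic continuation is intended.\<close>
definition zeta :: "complex \<Rightarrow> complex" where
  "zeta s = (\<Sum>k. of_nat (Suc k) powr (-s))"

end

theory Submission
  imports Defs
begin

text \<open>
  The series is the first-order coefficient, in a parameter \<open>y\<close>, of an accelerated series for \<open>\<zeta>(2)\<close>. Put
  \<open>T\<^sub>y(n, k) = (-1)\<^sup>k P(n + k) P(n) / Q(2 n + k + 1)\<close>, where \<open>P(m)\<close> and \<open>Q(m)\<close> are the products of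
  \<open>j\<^sup>3 - y\<close> and of \<open>j\<^sup>3 + y\<close> over \<open>1 \<le> j \<le> m\<close>. The term \<open>G\<^sub>y(n, k) = T\<^sub>y(n, k) (3 n + 2 k + 2)\<close> is a well-poised
  hypergeometric term and has a Wilf--Zeilberger mate \<open>F\<^sub>y\<close>, a rational multiple of \<open>T\<^sub>y\<close>, such that
  \<open>G\<^sub>y(n + 1, k) - G\<^sub>y(n, k) = F\<^sub>y(n, k + 1) - F\<^sub>y(n, k)\<close>. At \<open>y = 0\<close> the edge \<open>k = 0\<close> of
  \<open>F\<close> is \<open>(21 n + 13) n!\<^sup>6 / (8 (2 n + 1)!\<^sup>3)\<close> and the edge \<open>n = 0\<close> of \<open>G\<close> is \<open>2 (-1)\<^sup>k / (k + 1)\<^sup>2\<close>.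

  Differentiating in \<open>y\<close> at \<open>0\<close> multiplies terms by harmonic numbers of order 3, because \<open>P\<close> and \<open>Q\<close> depend on
  \<open>y\<close> through \<open>j\<^sup>3 \<mp> y\<close> only. The functions \<open>wz_G\<close> and \<open>wz_F\<close> are the negated
  derivatives in explicit form, and they satisfy the same difference equation (\<open>wz_pair\<close>). Along \<open>k = 0\<close>, eight
  times \<open>wz_F\<close> is the given summand (\<open>wz_F_0\<close>). Along \<open>n = 0\<close>, \<open>wz_G\<close> is
  \<open>2 (-1)\<^sup>k (H\<^sub>k + H\<^sub>k\<^sub>+\<^sub>1) / (k + 1)\<^sup>2\<close>, where \<open>H\<close> has order 3 (\<open>wz_G_0\<close>). Summing the difference equation over
  growing squares shows that both edges have the same sum (\<open>wz_sums_transfer\<close>).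

  What remains is an alternating Euler sum of odd weight, \<open>3/2 \<zeta>(2) \<zeta>(3) - 9/4 \<zeta>(5)\<close>
  (\<open>alternating_euler_sum\<close>). It comes from the absolutely convergent double sum of
  \<open>(-1)\<^sup>m / (m\<^sup>2 (m - j)\<^sup>3)\<close> over \<open>m \<in> \<int>\<close> and \<open>j \<ge> 1\<close>, evaluated in both orders: partial fractions in one order,
  tails of \<open>\<zeta>(3)\<close> in the other.
\<close>

section \<open>A Wilf--Zeilberger pair with harmonic numbers\<close>

lemma gen_harm_Suc: "gen_harm l (Suc n) = gen_harm l n + 1 / real (Suc n) ^ l"
  by (simp add: gen_harm_def)

lemma gen_harm_0 [simp]: "gen_harm l 0 = 0"
  by (simp add: gen_harm_def)

lemma gen_harm_nonneg: "0 \<le> gen_harm l n"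
  by (simp add: gen_harm_def sum_nonneg)

text \<open>The numerator polynomial of the companion \<open>F\<close>, written in \<open>N = n + 1\<close> and \<open>K = k\<close>. It is the solution,
  found by undetermined coefficients, of the Wilf--Zeilberger equation for \<open>G\<close>.\<close>
definition wz_poly :: "real \<Rightarrow> real \<Rightarrow> real" where
  "wz_poly N K = K^4 + 9*N*K^3 + 30*N^2*K^2 + 42*N^3*K + 21*N^4"

text \<open>The value at \<open>y = 0\<close> of
  \<open>T\<^sub>y(n, k) = (-1)\<^sup>k P(n + k) P(n) / Q(2 n + k + 1)\<close>, where \<open>P(m)\<close> and \<open>Q(m)\<close> are the products of
  \<open>j\<^sup>3 - y\<close> and of \<open>j\<^sup>3 + y\<close> over \<open>1 \<le> j \<le> m\<close>.\<close>
definition wz_base :: "nat \<Rightarrow> nat \<Rightarrow> real" where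
  "wz_base n k = (-1) ^ k * (fact (n + k) * fact n / fact (2*n + k + 1)) ^ 3"

text \<open>Minus the logarithmic derivative of \<open>T\<^sub>y(n, k)\<close> with respect to \<open>y\<close> at \<open>y = 0\<close>.\<close>
definition wz_harm :: "nat \<Rightarrow> nat \<Rightarrow> real" where
  "wz_harm n k = gen_harm 3 (n + k) + gen_harm 3 n + gen_harm 3 (2*n + k + 1)"

definition wz_G :: "nat \<Rightarrow> nat \<Rightarrow> real" where
  "wz_G n k = wz_base n k * (3 * real n + 2 * real k + 2) * wz_harm n k"

text \<open>With \<open>B = 2 N + K\<close> and \<open>M\<close> the polynomial above, the companion of \<open>T\<^sub>y(n, k) (3 n + 2 k + 2)\<close> is
  \<open>T\<^sub>y(n, k) ((M + 3 B y) / (B\<^sup>3 + y) - 1)\<close>. Minus its derivative at \<open>y = 0\<close> is \<open>T\<^sub>0(n, k)\<close> times the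
  following expression, with \<open>h\<close> as harmonic part.\<close>
definition wz_cert :: "real \<Rightarrow> real \<Rightarrow> real \<Rightarrow> real" where
  "wz_cert h N K = h * (wz_poly N K / (2*N+K)^3 - 1) - 3 / (2*N+K)^2 + wz_poly N K / (2*N+K)^6"

definition wz_F :: "nat \<Rightarrow> nat \<Rightarrow> real" where
  "wz_F n k = wz_base n k * wz_cert (wz_harm n k) (real n + 1) (real k)"

text \<open>Differentiated at \<open>y = 0\<close> and divided by \<open>T\<^sub>0(n, k)\<close>, the Wilf--Zeilberger equation is affine in
  \<open>h\<close>. The next two lemmas, cleared of denominators, are its coefficient of \<open>h\<close>, which is the equation
  at \<open>y = 0\<close>, and its part free of \<open>h\<close>.\<close>
lemma wz_identity_order_0:
  "(N+K)^3 * N^3 * (3*N+2*K+2) - (2*N+K)^3 * (2*N+K+1)^3 * (3*N+2*K-1)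
   = - ((N+K)^3) * (wz_poly N (K+1) - (2*N+K+1)^3) - (2*N+K+1)^3 * (wz_poly N K - (2*N+K)^3)"
  unfolding wz_poly_def by algebra

lemma wz_identity_order_1:
  "(3*N+2*K+2) * ((2*N+K)^3 * (2*N+K+1)^3 * ((N+K)^3 + N^3) + (N+K)^3 * N^3 * ((2*N+K)^3 + (2*N+K+1)^3))
   = - (((2*N+K)^3 + (N+K)^3) * (2*N+K+1)^3 * (wz_poly N (K+1) - (2*N+K+1)^3))
     + (N+K)^3 * (2*N+K)^3 * (3 * (2*N+K+1)^4 - wz_poly N (K+1))
     - (2*N+K+1)^6 * (wz_poly N K - 3 * (2*N+K)^4)"
  unfolding wz_poly_def by algebra

lemma wz_base_Suc_right:
  "wz_base n (Suc k) = - wz_base n k * (real n + real k + 1)^3 / (2 * real n + real k + 2)^3"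
  by (simp add: wz_base_def power_mult_distrib power_divide add_ac mult_ac)

lemma wz_base_Suc_left:
  "wz_base (Suc n) k = wz_base n k * ((real n + real k + 1) * (real n + 1))^3
     / ((2 * real n + real k + 2) * (2 * real n + real k + 3))^3"
proof -
  have "fact (2 * Suc n + k + 1) =
          (2 * real n + real k + 3) * ((2 * real n + real k + 2) * fact (2*n + k + 1))"
    by (simp add: add_ac)
  moreover have "fact (Suc n + k) = (real n + real k + 1) * fact (n + k)"
    by (simp add: add_ac)
  moreover have "fact (Suc n) = (real n + 1) * (fact n :: real)"
    by (simp add: add_ac)
  ultimately show ?thesis
    unfolding wz_base_def by (simp only: power_mult_distrib power_divide) (simp add: mult_ac)
qed

lemma wz_harm_Suc_right:
  "wz_harm n (Suc k) = wz_harm n k + 1 / (real n + real k + 1)^3 + 1 / (2 * real n + real k + 2)^3"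
  by (simp add: wz_harm_def gen_harm_Suc add_ac)

lemma wz_harm_Suc_left:
  "wz_harm (Suc n) k = wz_harm n k + 1 / (real n + real k + 1)^3 + 1 / (real n + 1)^3
     + 1 / (2 * real n + real k + 2)^3 + 1 / (2 * real n + real k + 3)^3"
  by (simp add: wz_harm_def gen_harm_Suc add_ac)

text \<open>The differentiated Wilf--Zeilberger equation, divided by \<open>T\<^sub>0(n, k)\<close>, with \<open>N = n + 1\<close> and
  \<open>K = k\<close>.\<close>
lemma wz_rational_identity:
  fixes N K h :: real
  assumes N: "N > 0" and K: "K \<ge> 0"
  shows "((N+K) * N)^3 / ((2*N+K) * (2*N+K+1))^3 * (3*N+2*K+2)
           * (h + 1/(N+K)^3 + 1/N^3 + 1/(2*N+K)^3 + 1/(2*N+K+1)^3) - (3*N+2*K-1) * h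
         = - ((N+K)^3 / (2*N+K)^3) * wz_cert (h + 1/(N+K)^3 + 1/(2*N+K)^3) N (K+1) - wz_cert h N K"
proof -
  define A B C M M' where A: "A = N + K" and B: "B = 2*N + K" and C: "C = 2*N + K + 1"
    and M: "M = wz_poly N K" and M': "M' = wz_poly N (K+1)"
  have nz: "A \<noteq> 0" "B \<noteq> 0" "C \<noteq> 0" "N \<noteq> 0" using N K by (auto simp: A B C)
  have C': "2*N + (K+1) = C" by (simp add: C)
  define D where "D = 3*N + 2*K"
  have id0: "A^3 * N^3 * (D+2) - B^3 * C^3 * (D-1) = - (A^3) * (M' - C^3) - C^3 * (M - B^3)"
    using wz_identity_order_0[of N K] by (simp add: A B C M M' D_def)
  have id1: "(D+2) * (B^3 * C^3 * (A^3 + N^3) + A^3 * N^3 * (B^3 + C^3))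
     = - ((B^3 + A^3) * C^3 * (M' - C^3)) + A^3 * B^3 * (3 * C^4 - M') - C^6 * (M - 3 * B^4)"
    using wz_identity_order_1[of N K] by (simp add: A B C M M' D_def)
  have "(A * N)^3 / (B * C)^3 * (D+2) * (h + 1/A^3 + 1/N^3 + 1/B^3 + 1/C^3) - (D-1) * h
     = h * (A^3 * N^3 * (D+2) - B^3 * C^3 * (D-1)) / (B^3 * C^3)
       + (D+2) * (B^3 * C^3 * (A^3 + N^3) + A^3 * N^3 * (B^3 + C^3)) / (B^6 * C^6)"
    using nz by (simp add: field_simps) algebra
  also have "\<dots> = h * (- (A^3) * (M' - C^3) - C^3 * (M - B^3)) / (B^3 * C^3)
     + (- ((B^3 + A^3) * C^3 * (M' - C^3)) + A^3 * B^3 * (3 * C^4 - M') - C^6 * (M - 3 * B^4)) / (B^6 * C^6)"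
    by (simp only: id0 id1)
  also have "\<dots> = - (A^3 / B^3) * ((h + 1/A^3 + 1/B^3) * (M' / C^3 - 1) - 3 / C^2 + M' / C^6)
      - (h * (M / B^3 - 1) - 3 / B^2 + M / B^6)"
    using nz by (simp add: field_simps) algebra
  finally show ?thesis
    unfolding wz_cert_def C' by (simp add: A B C M M' D_def)
qed

lemma wz_pair: "wz_G (Suc n) k - wz_G n k = wz_F n (Suc k) - wz_F n k"
proof -
  define t h N K where "t = wz_base n k" "h = wz_harm n k" "N = real n + 1" "K = real k"
  note defs = this
  have "wz_G (Suc n) k - wz_G n k = t * (((N+K) * N)^3 / ((2*N+K) * (2*N+K+1))^3 * (3*N+2*K+2)
           * (h + 1/(N+K)^3 + 1/N^3 + 1/(2*N+K)^3 + 1/(2*N+K+1)^3) - (3*N+2*K-1) * h)"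
    unfolding wz_G_def wz_base_Suc_left wz_harm_Suc_left by (simp add: defs algebra_simps)
  also have "\<dots> = t * (- ((N+K)^3 / (2*N+K)^3) * wz_cert (h + 1/(N+K)^3 + 1/(2*N+K)^3) N (K+1) - wz_cert h N K)"
    by (subst wz_rational_identity) (simp_all add: defs)
  also have "\<dots> = wz_F n (Suc k) - wz_F n k"
    unfolding wz_F_def wz_base_Suc_right wz_harm_Suc_right by (simp add: defs algebra_simps)
  finally show ?thesis .
qed

section \<open>Equality of the two edge sums\<close>

lemma gen_harm_3_le_2: "gen_harm 3 n \<le> 2"
proof -
  \<comment> \<open>The stronger bound is what survives induction, by comparison with a telescoping sum.\<close>
  have "gen_harm 3 (Suc n) \<le> 2 - 1 / real (Suc n)" for n
  proof (induction n)
    case 0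
    then show ?case by (simp add: gen_harm_Suc)
  next
    case (Suc n)
    have "real (n + 1) * real (n + 2) \<le> real (n + 2) ^ 3"
      by (simp add: power3_eq_cube algebra_simps)
    then have "1 / real (n + 2) ^ 3 \<le> 1 / (real (n + 1) * real (n + 2))"
      by (intro divide_left_mono) (auto intro!: mult_pos_pos)
    also have "\<dots> = 1 / real (n + 1) - 1 / real (n + 2)"
      by (simp add: field_simps)
    finally show ?case
      using Suc by (simp add: gen_harm_Suc)
  qed
  then have "gen_harm 3 (Suc n) \<le> 2" for n
    by (rule order_trans) simp
  then show ?thesis
    by (cases n) simp_all
qed

text \<open>The quotient of factorials is the reciprocal of \<open>2 n + k + 1\<close> times a binomial coefficient, and the
  latter is at least 1.\<close>
lemma abs_wz_base_le: "\<bar>wz_base n k\<bar> \<le> 1 / real (2*n + k + 1) ^ 3"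
proof -
  have "fact (n + k) * fact n dvd (fact (n + k + n) :: nat)"
    by (rule fact_fact_dvd_fact)
  then have "fact (n + k) * fact n \<le> (fact (2*n + k) :: nat)"
    by (intro dvd_imp_le) (simp_all add: mult_2 add_ac)
  then have "fact (n + k) * fact n \<le> (fact (2*n + k) :: real)"
    by (metis of_nat_fact of_nat_le_iff of_nat_mult)
  then have "fact (n + k) * fact n / fact (2*n + k + 1)
      \<le> fact (2*n + k) / (real (2*n + k + 1) * fact (2*n + k))"
    by (simp only: Suc_eq_plus1[symmetric] fact_Suc of_nat_mult of_nat_fact) (intro divide_right_mono, auto)
  also have "\<dots> = 1 / real (2*n + k + 1)"
    by (simp only: nonzero_divide_mult_cancel_right fact_nonzero not_False_eq_True)
  finally have "fact (n + k) * fact n / fact (2*n + k + 1) \<le> 1 / real (2*n + k + 1)" .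
  then have "(fact (n + k) * fact n / fact (2*n + k + 1)) ^ 3 \<le> (1 / real (2*n + k + 1)) ^ 3"
    by (intro power_mono) auto
  then show ?thesis
    by (simp add: wz_base_def abs_mult power_one_over)
qed

lemma wz_harm_bounds: "0 \<le> wz_harm n k" "wz_harm n k \<le> 6"
  using gen_harm_nonneg[of 3] gen_harm_3_le_2[of "n + k"] gen_harm_3_le_2[of n]
    gen_harm_3_le_2[of "2*n + k + 1"]
  by (auto simp: wz_harm_def intro!: add_nonneg_nonneg)

text \<open>With \<open>B = 2 N + K\<close>, the numerator polynomial lies between \<open>B\<^sup>4\<close> and \<open>2 B\<^sup>4\<close>. So the rational factor
  of \<open>F\<close> grows only linearly, like that of \<open>G\<close>.\<close>
lemma abs_wz_cert_le:
  fixes N K h :: real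
  assumes N: "N \<ge> 1" and K: "K \<ge> 0" and h: "0 \<le> h" "h \<le> 6"
  shows "\<bar>wz_cert h N K\<bar> \<le> 29 * (2*N + K - 1)"
proof -
  define B where "B = 2*N + K"
  have B: "B \<ge> 2" using N K by (simp add: B_def)
  have upper: "wz_poly N K \<le> 2 * B^4"
  proof -
    have "2 * B^4 - wz_poly N K = K^4 + 7*N*K^3 + 18*N^2*K^2 + 22*N^3*K + 11*N^4"
      by (simp add: wz_poly_def B_def) algebra
    moreover have "\<dots> \<ge> 0" using N K by (intro add_nonneg_nonneg) auto
    ultimately show ?thesis by linarith
  qed
  have lower: "wz_poly N K \<ge> B^4"
  proof -
    have "wz_poly N K - B^4 = N*K^3 + 6*N^2*K^2 + 10*N^3*K + 5*N^4"
      by (simp add: wz_poly_def B_def) algebra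
    moreover have "\<dots> \<ge> 0" using N K by (intro add_nonneg_nonneg) auto
    ultimately show ?thesis by linarith
  qed
  have "wz_poly N K / B^3 \<le> 2 * B" "B \<le> wz_poly N K / B^3"
    using upper lower B by (simp_all add: field_simps eval_nat_numeral)
  then have "0 \<le> wz_poly N K / B^3 - 1" "wz_poly N K / B^3 - 1 \<le> 2 * B"
    using B by linarith+
  then have "0 \<le> h * (wz_poly N K / B^3 - 1)" "h * (wz_poly N K / B^3 - 1) \<le> 12 * B"
    using h mult_mono[of h 6 "wz_poly N K / B^3 - 1" "2 * B"] by (auto intro!: mult_nonneg_nonneg)
  moreover have "0 \<le> 3 / B^2" "3 / B^2 \<le> 3"
    using B power_mono[of 1 B 2] by (simp_all add: field_simps)
  moreover have "0 \<le> wz_poly N K / B^6"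
    using lower B by (auto intro!: divide_nonneg_nonneg order_trans[OF _ lower])
  moreover have "wz_poly N K / B^6 \<le> 2"
  proof -
    have "2 * B^4 \<le> 2 * B^6" using B by (auto intro!: power_increasing)
    with upper have "wz_poly N K \<le> 2 * B^6" by linarith
    then show ?thesis using B by (simp add: divide_simps)
  qed
  moreover have "\<bar>x - y + z\<bar> \<le> 29 * B - 29"
    if "0 \<le> x" "x \<le> 12 * B" "0 \<le> y" "y \<le> 3" "0 \<le> z" "z \<le> 2" for x y z
    using that B by linarith
  ultimately show ?thesis
    unfolding wz_cert_def B_def[symmetric] right_diff_distrib by simp
qed

lemma abs_wz_F_le: "\<bar>wz_F n k\<bar> \<le> 29 / real (2*n + k + 1) ^ 2"
proof -
  define b where "b = real (2*n + k + 1)"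
  have b: "b > 0" by (simp add: b_def)
  have "\<bar>wz_cert (wz_harm n k) (real n + 1) (real k)\<bar> \<le> 29 * b"
    using abs_wz_cert_le[of "real n + 1" "real k" "wz_harm n k"] wz_harm_bounds
    by (simp add: b_def)
  then have "\<bar>wz_F n k\<bar> \<le> 1 / b^3 * (29 * b)"
    unfolding wz_F_def abs_mult b_def
    by (intro mult_mono abs_wz_base_le) auto
  also have "\<dots> = 29 / b^2"
    using b by (simp add: eval_nat_numeral)
  finally show ?thesis by (simp add: b_def)
qed

lemma abs_wz_G_le: "\<bar>wz_G n k\<bar> \<le> 12 / real (2*n + k + 1) ^ 2"
proof -
  define b where "b = real (2*n + k + 1)"
  have b: "b > 0" by (simp add: b_def)
  have "\<bar>wz_G n k\<bar> \<le> 1 / b^3 * (2 * b) * 6"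
    unfolding wz_G_def abs_mult b_def
    by (intro mult_mono abs_wz_base_le) (use wz_harm_bounds in auto)
  also have "\<dots> = 12 / b^2"
    using b by (simp add: eval_nat_numeral)
  finally show ?thesis by (simp add: b_def)
qed

lemma wz_rectangle:
  "(\<Sum>n<N. wz_F n 0) - (\<Sum>k<K. wz_G 0 k) = (\<Sum>n<N. wz_F n K) - (\<Sum>k<K. wz_G N k)"
proof -
  have "(\<Sum>n<N. wz_F n K - wz_F n 0) = (\<Sum>n<N. \<Sum>k<K. wz_F n (Suc k) - wz_F n k)"
    by (simp add: sum_lessThan_telescope)
  also have "\<dots> = (\<Sum>k<K. \<Sum>n<N. wz_G (Suc n) k - wz_G n k)"
    by (subst sum.swap) (simp add: wz_pair)
  also have "\<dots> = (\<Sum>k<K. wz_G N k - wz_G 0 k)"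
    by (subst sum_lessThan_telescope[of "\<lambda>n. wz_G n k" N for k]) simp
  finally show ?thesis
    by (simp add: sum_subtractf)
qed

text \<open>Summation over the square \<open>n, k < K\<close>. Both far edges consist of \<open>K\<close> terms of size
  \<open>O(1 / K\<^sup>2)\<close>, hence vanish in the limit.\<close>
lemma wz_sums_transfer:
  assumes "wz_G 0 sums s"
  shows "(\<lambda>n. wz_F n 0) sums s"
proof -
  have bound: "\<bar>(\<Sum>n<K. wz_F n 0) - (\<Sum>k<K. wz_G 0 k)\<bar> \<le> 41 / real (Suc K)" for K
  proof -
    have "\<bar>\<Sum>n<K. wz_F n K\<bar> \<le> (\<Sum>n<K. 29 / real (Suc K) ^ 2)"
      by (intro order_trans[OF sum_abs] sum_mono order_trans[OF abs_wz_F_le] divide_left_mono power_mono)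
         auto
    moreover have "\<bar>\<Sum>k<K. wz_G K k\<bar> \<le> (\<Sum>k<K. 12 / real (Suc K) ^ 2)"
      by (intro order_trans[OF sum_abs] sum_mono order_trans[OF abs_wz_G_le] divide_left_mono power_mono)
         auto
    ultimately have "\<bar>(\<Sum>n<K. wz_F n 0) - (\<Sum>k<K. wz_G 0 k)\<bar> \<le> real K * 41 / real (Suc K) ^ 2"
      unfolding wz_rectangle sum_constant card_lessThan
      by (simp only: times_divide_eq_right[symmetric] distrib_left add_divide_distrib)
    also have "\<dots> \<le> real (Suc K) * 41 / real (Suc K) ^ 2"
      by (intro divide_right_mono mult_right_mono) auto
    also have "\<dots> = 41 / real (Suc K)"
      by (simp add: power2_eq_square del: of_nat_Suc)
    finally show ?thesis .
  qed
  have "(\<lambda>K. 41 / real (Suc K)) \<longlonglongrightarrow> 0"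
    using tendsto_mult_right_zero[OF LIMSEQ_inverse_real_of_nat, of 41] by (simp add: divide_inverse)
  then have "(\<lambda>K. (\<Sum>n<K. wz_F n 0) - (\<Sum>k<K. wz_G 0 k)) \<longlonglongrightarrow> 0"
    by (rule Lim_null_comparison[rotated]) (use bound in auto)
  from tendsto_add[OF this assms[unfolded sums_def]] show ?thesis
    by (simp add: sums_def)
qed

lemma wz_G_0: "wz_G 0 k = 2 * ((-1) ^ k / real (Suc k) ^ 2 * (gen_harm 3 k + gen_harm 3 (Suc k)))"
proof -
  have "wz_base 0 k = (-1) ^ k / real (Suc k) ^ 3"
    by (simp add: wz_base_def power_divide power_mult_distrib)
  then show ?thesis
    by (simp add: wz_G_def wz_harm_def eval_nat_numeral divide_simps) (simp add: algebra_simps)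
qed

lemma pochhammer_quotient:
  "pochhammer 1 k / pochhammer (3/2) k = 4 ^ k * (fact k * fact k / fact (2*k + 1) :: real)"
proof (induction k)
  case (Suc k)
  have "pochhammer 1 (Suc k) / pochhammer (3/2) (Suc k)
      = pochhammer 1 k / pochhammer (3/2) k * ((1 + real k) / (3/2 + real k))"
    by (simp add: pochhammer_Suc)
  also have "\<dots> = 4 ^ k * (fact k * fact k / fact (2*k + 1)) * ((1 + real k) / (3/2 + real k))"
    by (simp only: Suc)
  also have "\<dots> = 4 ^ Suc k * (fact (Suc k) * fact (Suc k) / fact (2 * Suc k + 1))"
    by (simp add: divide_simps add_eq_0_iff) (simp add: algebra_simps)
  finally show ?case .
qed simp

lemma wz_F_0:
  "8 * wz_F k 0 = (1/64) ^ k * (pochhammer 1 k ^ 3 / pochhammer (3/2) k ^ 3) *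
            ((21 * real k + 13) * (gen_harm 3 (2*k+1) + 2 * gen_harm 3 k)
             - 27 / (8 * (real k + 1) ^ 2))"
proof -
  have "(1/64) ^ k * (pochhammer 1 k ^ 3 / pochhammer (3/2) k ^ 3 :: real)
      = (1/64) ^ k * (pochhammer 1 k / pochhammer (3/2) k) ^ 3"
    by (simp add: power_divide)
  also have "\<dots> = ((1/64) ^ k * (4 ^ k) ^ 3) * (fact k * fact k / fact (2*k + 1)) ^ 3"
    unfolding pochhammer_quotient by (simp only: power_mult_distrib mult_ac)
  also have "(1/64) ^ k * (4 ^ k) ^ 3 = (1 :: real)"
    by (simp add: power_mult_distrib[symmetric] power_mult[symmetric] mult.commute[of k 3] power_mult[of 4 3])
  finally have base: "(1/64) ^ k * (pochhammer 1 k ^ 3 / pochhammer (3/2) k ^ 3 :: real) = wz_base k 0"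
    by (simp add: wz_base_def)
  have "8 * wz_cert h N 0 = (21 * N - 8) * h - 27 / (8 * N^2)" if "N > 0" for h N :: real
    using that by (simp add: wz_cert_def wz_poly_def field_simps eval_nat_numeral)
  from this[of "real k + 1" "wz_harm k 0"]
  have "8 * wz_cert (wz_harm k 0) (real k + 1) (real 0)
      = (21 * real k + 13) * (gen_harm 3 (2*k+1) + 2 * gen_harm 3 k) - 27 / (8 * (real k + 1) ^ 2)"
    by (simp add: wz_harm_def algebra_simps)
  then show ?thesis
    unfolding base wz_F_def by simp
qed

section \<open>An alternating Euler sum of weight 5\<close>

definition alt_sign :: "int \<Rightarrow> real" where
  "alt_sign m = (if even m then 1 else -1)"

text \<open>Since \<open>inverse 0 = 0\<close>, sums of \<open>rcp\<close> powers can run over all of \<open>\<int>\<close>, poles included. This makes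
  translations and reflections of the summation index bijections of the index set.\<close>
abbreviation rcp :: "int \<Rightarrow> real" where
  "rcp m \<equiv> inverse (of_int m)"

definition zeta_nat :: "nat \<Rightarrow> real" where
  "zeta_nat r = (\<Sum>n. 1 / real (Suc n) ^ r)"

lemma rcp_minus: "rcp (- m) = - rcp m"
  by (simp add: inverse_minus_eq)

lemma has_sum_eqI:
  assumes "(f has_sum a) A" "\<And>x. x \<in> A \<Longrightarrow> f x = g x" "a = b"
  shows "(g has_sum b) A"
  using assms has_sum_cong by blast

lemma has_sum_diff_real:
  fixes f g :: "'a \<Rightarrow> real"
  assumes "(f has_sum a) A" "(g has_sum b) A"
  shows "((\<lambda>x. f x - g x) has_sum (a - b)) A"
  using has_sum_add[OF assms(1) has_sum_uminusI[OF assms(2)]] by simp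

lemma has_sum_int_split:
  fixes f :: "int \<Rightarrow> real"
  assumes pos: "((\<lambda>n. f (int (Suc n))) has_sum a) UNIV"
    and neg: "((\<lambda>n. f (- int (Suc n))) has_sum b) UNIV"
  shows "(f has_sum (f 0 + (a + b))) UNIV"
proof -
  have "(f has_sum a) {0<..}"
    using pos by (subst (asm) has_sum_reindex_bij_witness[where i = "\<lambda>m. nat m - 1" and j = "\<lambda>n. int (Suc n)"
        and h = f and T = "{0<..}" and s' = a]) auto
  moreover have "(f has_sum b) {..<0}"
    using neg by (subst (asm) has_sum_reindex_bij_witness[where i = "\<lambda>m. nat (-m) - 1" and j = "\<lambda>n. - int (Suc n)"
        and h = f and T = "{..<0}" and s' = b]) auto
  ultimately have "(f has_sum (a + b)) ({0<..} \<union> {..<0})"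
    by (rule has_sum_Un_disjoint) auto
  then have "(f has_sum (f 0 + (a + b))) (insert 0 ({0<..} \<union> {..<0}))"
    by (intro has_sum_insert) auto
  moreover have "insert 0 ({0<..} \<union> {..<0}) = (UNIV :: int set)"
    by auto
  ultimately show ?thesis by simp
qed

lemma has_sum_int_shift:
  fixes f :: "int \<Rightarrow> real"
  shows "((\<lambda>m. f (m - j)) has_sum s) UNIV \<longleftrightarrow> (f has_sum s) UNIV"
  by (rule has_sum_reindex_bij_witness[where i = "\<lambda>m. m + j" and j = "\<lambda>m. m - j"]) auto

lemma has_sum_zeta_nat:
  assumes "r \<ge> 2"
  shows "((\<lambda>n. inverse (real (Suc n)) ^ r) has_sum zeta_nat r) UNIV"
proof -
  have "summable (\<lambda>n. inverse (real n ^ r))"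
    using assms by (rule inverse_power_summable)
  then have "summable (\<lambda>n. inverse (real (Suc n) ^ r))"
    by (subst summable_Suc_iff)
  then have "(\<lambda>n. inverse (real (Suc n)) ^ r) sums zeta_nat r"
    unfolding zeta_nat_def by (simp add: summable_sums divide_inverse power_inverse)
  then show ?thesis
    by (rule sums_nonneg_imp_has_sum) auto
qed

text \<open>The alternating series is twice its even part minus the whole series.\<close>
lemma has_sum_eta_nat:
  assumes "r \<ge> 2"
  shows "((\<lambda>n. alt_sign (int (Suc n)) * inverse (real (Suc n)) ^ r)
           has_sum (2 / 2 ^ r - 1) * zeta_nat r) UNIV"
proof -
  have "((\<lambda>n. (1 / 2) ^ r * inverse (real (Suc n)) ^ r) has_sum (1 / 2) ^ r * zeta_nat r) UNIV"
    by (intro has_sum_cmult_right has_sum_zeta_nat assms)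
  then have "((\<lambda>n. inverse (real (Suc n)) ^ r) has_sum (1 / 2) ^ r * zeta_nat r) {n. even (Suc n)}"
    by (subst (asm) has_sum_reindex_bij_witness[where i = "\<lambda>n. n div 2" and j = "\<lambda>n. 2*n + 1"
        and h = "\<lambda>n. inverse (real (Suc n)) ^ r" and T = "{n. even (Suc n)}" and s' = "(1 / 2) ^ r * zeta_nat r"])
      (auto elim!: oddE simp: power_mult_distrib[symmetric] field_simps)
  also have "?this \<longleftrightarrow> ((\<lambda>n. if even (Suc n) then inverse (real (Suc n)) ^ r else 0)
      has_sum (1 / 2) ^ r * zeta_nat r) UNIV"
    by (rule has_sum_cong_neutral) auto
  finally have "((\<lambda>n. 2 * (if even (Suc n) then inverse (real (Suc n)) ^ r else 0)
       - inverse (real (Suc n)) ^ r) has_sum 2 * ((1 / 2) ^ r * zeta_nat r) - zeta_nat r) UNIV"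
    by (intro has_sum_diff_real has_sum_cmult_right has_sum_zeta_nat assms)
  then show ?thesis
    by (rule has_sum_eqI) (auto simp: alt_sign_def power_one_over field_simps)
qed

lemma has_sum_alt_even_power:
  assumes "r \<ge> 2" "even r"
  shows "((\<lambda>m. alt_sign m * rcp m ^ r) has_sum 2 * (2 / 2 ^ r - 1) * zeta_nat r) UNIV"
proof -
  define s where "s = (2 / 2 ^ r - 1) * zeta_nat r"
  have "((\<lambda>m. alt_sign m * rcp m ^ r) has_sum (alt_sign 0 * rcp 0 ^ r + (s + s))) UNIV"
  proof (rule has_sum_int_split)
    show "((\<lambda>n. alt_sign (int (Suc n)) * rcp (int (Suc n)) ^ r) has_sum s) UNIV"
      using has_sum_eta_nat[OF assms(1)] by (simp add: s_def)
    then show "((\<lambda>n. alt_sign (- int (Suc n)) * rcp (- int (Suc n)) ^ r) has_sum s) UNIV"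
      by (rule has_sum_eqI) (use assms in \<open>simp_all only: rcp_minus power_minus_even alt_sign_def even_minus\<close>)
  qed
  then show ?thesis
    by (rule has_sum_eqI) (use assms in \<open>simp_all add: s_def zero_power\<close>)
qed

lemma has_sum_alt_odd_power:
  assumes "r \<ge> 2" "odd r"
  shows "((\<lambda>m. alt_sign m * rcp m ^ r) has_sum 0) UNIV"
proof -
  define s where "s = (2 / 2 ^ r - 1) * zeta_nat r"
  have "((\<lambda>m. alt_sign m * rcp m ^ r) has_sum (alt_sign 0 * rcp 0 ^ r + (s + - s))) UNIV"
  proof (rule has_sum_int_split)
    show *: "((\<lambda>n. alt_sign (int (Suc n)) * rcp (int (Suc n)) ^ r) has_sum s) UNIV"
      using has_sum_eta_nat[OF assms(1)] by (simp add: s_def)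
    show "((\<lambda>n. alt_sign (- int (Suc n)) * rcp (- int (Suc n)) ^ r) has_sum - s) UNIV"
      by (rule has_sum_eqI[OF has_sum_uminusI[OF *]])
         (use assms in \<open>simp_all only: rcp_minus power_minus_odd alt_sign_def even_minus mult_minus_right simp_thms\<close>)
  qed
  then show ?thesis
    by (rule has_sum_eqI) (use assms in \<open>simp_all add: zero_power\<close>)
qed

lemma summable_int_power:
  assumes "r \<ge> 2"
  shows "(\<lambda>m. \<bar>rcp m\<bar> ^ r) summable_on UNIV"
proof -
  have "((\<lambda>m. \<bar>rcp m\<bar> ^ r) has_sum (\<bar>rcp 0\<bar> ^ r + (zeta_nat r + zeta_nat r))) UNIV"
  proof (rule has_sum_int_split)
    show "((\<lambda>n. \<bar>rcp (int (Suc n))\<bar> ^ r) has_sum zeta_nat r) UNIV"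
      by (rule has_sum_eqI[OF has_sum_zeta_nat[OF assms]]) simp_all
    then show "((\<lambda>n. \<bar>rcp (- int (Suc n))\<bar> ^ r) has_sum zeta_nat r) UNIV"
      by (simp only: rcp_minus abs_minus_cancel)
  qed
  then show ?thesis by (rule has_sum_imp_summable)
qed

text \<open>The reflection \<open>m \<mapsto> 1 - m\<close> negates the summand.\<close>
lemma has_sum_alt_rcp_step: "((\<lambda>m. alt_sign m * (rcp (m - 1) - rcp m)) has_sum 0) UNIV"
proof -
  let ?f = "\<lambda>m. alt_sign m * (rcp (m - 1) - rcp m)"
  have sq: "(\<lambda>m. \<bar>rcp m\<bar>\<^sup>2) summable_on UNIV"
    by (rule summable_int_power) simp
  then have "(\<lambda>m. \<bar>rcp (m - 1)\<bar>\<^sup>2) summable_on UNIV"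
    using has_sum_int_shift[of "\<lambda>m. \<bar>rcp m\<bar>\<^sup>2" 1] by (auto simp: summable_on_def)
  with sq have dom: "(\<lambda>m. \<bar>rcp m\<bar>\<^sup>2 + \<bar>rcp (m - 1)\<bar>\<^sup>2) summable_on UNIV"
    by (intro summable_on_add)
  \<comment> \<open>Where neither reciprocal is \<open>0\<close> by convention, the difference is the product of the two.\<close>
  have "norm (?f m) \<le> \<bar>rcp m\<bar>\<^sup>2 + \<bar>rcp (m - 1)\<bar>\<^sup>2" for m
  proof (cases "m = 0 \<or> m = 1")
    case False
    then have "rcp (m - 1) - rcp m = rcp m * rcp (m - 1)"
      by (simp add: field_simps)
    moreover have "\<bar>rcp m * rcp (m - 1)\<bar> \<le> \<bar>rcp m\<bar>\<^sup>2 + \<bar>rcp (m - 1)\<bar>\<^sup>2"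
      using sum_squares_bound[of "\<bar>rcp m\<bar>" "\<bar>rcp (m - 1)\<bar>"]
        mult_nonneg_nonneg[OF abs_ge_zero[of "rcp m"] abs_ge_zero[of "rcp (m - 1)"]]
      unfolding abs_mult by linarith
    ultimately show ?thesis
      by (simp add: abs_mult alt_sign_def)
  qed (auto simp: alt_sign_def)
  then have "(\<lambda>m. norm (?f m)) summable_on UNIV"
    by (intro summable_on_comparison_test[OF dom]) auto
  then obtain s where s: "(?f has_sum s) UNIV"
    by (metis abs_summable_summable summable_on_def)
  have "?f (1 - m) = - ?f m" for m
  proof -
    have "rcp (1 - m - 1) = - rcp m" "rcp (1 - m) = - rcp (m - 1)"
      using rcp_minus[of m] rcp_minus[of "m - 1"] by simp_all
    then show ?thesis by (simp add: alt_sign_def)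
  qed
  then have "((\<lambda>m. - ?f m) has_sum s) UNIV \<longleftrightarrow> (?f has_sum s) UNIV"
    by (intro has_sum_reindex_bij_witness[where i = "\<lambda>m. 1 - m" and j = "\<lambda>m. 1 - m"]) auto
  with s have "((\<lambda>m. - ?f m) has_sum s) UNIV" by simp
  with has_sum_uminusI[OF s] have "s = - s"
    using has_sum_unique by blast
  with s show ?thesis by simp
qed

text \<open>The two simple-pole terms of the partial fraction decomposition below have opposite residues. Each
  alone gives only a conditionally convergent sum; together they contribute nothing, as a telescoping
  sum of translates of the previous summand.\<close>
lemma has_sum_alt_rcp_diff: "((\<lambda>m. alt_sign m * (rcp (m - int j) - rcp m)) has_sum 0) UNIV"
proof (induction j)
  case (Suc j)
  have "((\<lambda>m. alt_sign (m - int j) * (rcp (m - int j - 1) - rcp (m - int j))) has_sum 0) UNIV"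
    using has_sum_alt_rcp_step has_sum_int_shift[of "\<lambda>m. alt_sign m * (rcp (m - 1) - rcp m)" "int j" 0]
    by simp
  then have "((\<lambda>m. alt_sign (int j) * (alt_sign (m - int j) * (rcp (m - int j - 1) - rcp (m - int j)))) has_sum alt_sign (int j) * 0) UNIV"
    by (rule has_sum_cmult_right)
  then have "((\<lambda>m. alt_sign m * (rcp (m - int j - 1) - rcp (m - int j))) has_sum 0) UNIV"
    by (rule has_sum_eqI) (auto simp: alt_sign_def)
  from has_sum_add[OF this Suc] show ?case
    by (rule has_sum_eqI) (auto simp: algebra_simps)
qed simp


lemma partial_fractions_2_3:
  fixes x y :: real
  assumes "x \<noteq> 0" "y \<noteq> 0" "y - x \<noteq> 0"
  shows "inverse y ^ 2 * inverse (y - x) ^ 3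
       = 3 / x^4 * (inverse (y - x) - inverse y) - 1 / x^3 * inverse y ^ 2
         - 2 / x^3 * inverse (y - x) ^ 2 + 1 / x^2 * inverse (y - x) ^ 3"
proof -
  define l where "l = y - x"
  have "y = l + x" by (simp add: l_def)
  have nz: "x \<noteq> 0" "l \<noteq> 0" "l + x \<noteq> 0" using assms by (auto simp: l_def)
  have "inverse (l + x) ^ 2 * inverse l ^ 3
       = 3 / x^4 * (inverse l - inverse (l + x)) - 1 / x^3 * inverse (l + x) ^ 2
         - 2 / x^3 * inverse l ^ 2 + 1 / x^2 * inverse l ^ 3"
    using nz by (simp add: divide_simps) algebra
  then show ?thesis unfolding \<open>y = l + x\<close> by simp
qed

lemma has_sum_single_point:
  fixes c :: real
  shows "((\<lambda>m. if m = a then c else 0) has_sum c) UNIV"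
  by (rule has_sum_finite_neutralI[of "{a}"]) auto

text \<open>Partial fractions in \<open>m\<close> reduce the sum to alternating zeta values over \<open>\<int>\<close>, and only the even order
  survives. The decomposition fails at \<open>m = 0\<close> and \<open>m = j\<close>, where the left side is \<open>0\<close> by convention; the
  defects at these two points are the terms in \<open>j\<^sup>-\<^sup>5\<close>.\<close>
lemma alternating_column_sum:
  assumes "j > 0"
  shows "((\<lambda>m. alt_sign m * rcp m ^ 2 * rcp (m - int j) ^ 3) has_sum
     (6 * inverse (real j) ^ 5 + 4 * (alt_sign (int j) * inverse (real j) ^ 5)
      + zeta_nat 2 * inverse (real j) ^ 3 + 2 * zeta_nat 2 * (alt_sign (int j) * inverse (real j) ^ 3))) UNIV"
proof -
  define x where "x = real j"
  have x: "x \<noteq> 0" using assms by (simp add: x_def)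
  have shift: "((\<lambda>m. alt_sign m * f (m - int j)) has_sum alt_sign (int j) * s) UNIV"
    if "((\<lambda>m. alt_sign m * f m) has_sum s) UNIV" for f s
  proof -
    have "((\<lambda>m. alt_sign (m - int j) * f (m - int j)) has_sum s) UNIV"
      using that has_sum_int_shift[of "\<lambda>m. alt_sign m * f m"] by blast
    then have "((\<lambda>m. alt_sign (int j) * (alt_sign (m - int j) * f (m - int j)))
        has_sum alt_sign (int j) * s) UNIV"
      by (rule has_sum_cmult_right)
    then show ?thesis
      by (rule has_sum_eqI) (auto simp: alt_sign_def)
  qed
  have sq: "((\<lambda>m. alt_sign m * rcp m ^ 2) has_sum - zeta_nat 2) UNIV"
    using has_sum_alt_even_power[of 2] by simp
  have cube: "((\<lambda>m. alt_sign m * rcp m ^ 3) has_sum 0) UNIV"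
    by (rule has_sum_alt_odd_power) auto
  have "((\<lambda>m. 3 / x^4 * (alt_sign m * (rcp (m - int j) - rcp m))
          - 1 / x^3 * (alt_sign m * rcp m ^ 2)
          - 2 / x^3 * (alt_sign m * rcp (m - int j) ^ 2)
          + 1 / x^2 * (alt_sign m * rcp (m - int j) ^ 3)
          + (if m = 0 then 6 / x^5 else 0)
          + (if m = int j then 4 * alt_sign (int j) / x^5 else 0))
       has_sum (3 / x^4 * 0 - 1 / x^3 * (- zeta_nat 2)
          - 2 / x^3 * (alt_sign (int j) * (- zeta_nat 2))
          + 1 / x^2 * (alt_sign (int j) * 0) + 6 / x^5 + 4 * alt_sign (int j) / x^5)) UNIV"
    by (intro has_sum_add has_sum_diff_real has_sum_cmult_right has_sum_single_point
          has_sum_alt_rcp_diff shift[OF sq] shift[OF cube] sq)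
  then show ?thesis
  proof (rule has_sum_eqI)
    fix m :: int
    consider "m = 0" | "m = int j" | "m \<noteq> 0" "m \<noteq> int j" by blast
    then show "3 / x^4 * (alt_sign m * (rcp (m - int j) - rcp m))
          - 1 / x^3 * (alt_sign m * rcp m ^ 2)
          - 2 / x^3 * (alt_sign m * rcp (m - int j) ^ 2)
          + 1 / x^2 * (alt_sign m * rcp (m - int j) ^ 3)
          + (if m = 0 then 6 / x^5 else 0)
          + (if m = int j then 4 * alt_sign (int j) / x^5 else 0)
        = alt_sign m * rcp m ^ 2 * rcp (m - int j) ^ 3"
    proof cases
      case 1
      then show ?thesis using x assms
        by (simp add: x_def[symmetric] alt_sign_def rcp_minus[simplified] divide_simps eval_nat_numeral)
    next
      case 2
      then show ?thesis using x assms
        by (simp add: x_def[symmetric] divide_simps eval_nat_numeral)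
    next
      case 3
      then have "of_int m - x \<noteq> 0"
        unfolding x_def by (metis eq_iff_diff_eq_0 of_int_eq_iff of_int_of_nat_eq)
      with partial_fractions_2_3[of x "of_int m"] 3 x
      have "alt_sign m * (inverse (of_int m) ^ 2 * inverse (of_int m - x) ^ 3) = alt_sign m *
          (3 / x^4 * (inverse (of_int m - x) - inverse (of_int m)) - 1 / x^3 * inverse (of_int m) ^ 2
         - 2 / x^3 * inverse (of_int m - x) ^ 2 + 1 / x^2 * inverse (of_int m - x) ^ 3)"
        by simp
      with 3 show ?thesis
        by (simp add: x_def[symmetric] algebra_simps diff_divide_distrib)
    qed
  qed (simp add: x_def[symmetric] divide_inverse power_inverse algebra_simps)
qed

lemma has_sum_nat_Suc_iff:
  fixes f :: "nat \<Rightarrow> real"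
  shows "((\<lambda>n. f (Suc n)) has_sum s) UNIV \<longleftrightarrow> (f has_sum (f 0 + s)) UNIV"
proof -
  have fwd: "(f has_sum (f 0 + t)) UNIV" if "((\<lambda>n. f (Suc n)) has_sum t) UNIV" for t
  proof -
    have "(f has_sum t) (range Suc)"
      using that by (subst has_sum_reindex) (auto simp: o_def)
    then have "(f has_sum (f 0 + t)) (insert 0 (range Suc))"
      by (intro has_sum_insert) auto
    then show ?thesis by (simp flip: UNIV_nat_eq)
  qed
  show ?thesis
  proof
    assume *: "(f has_sum (f 0 + s)) UNIV"
    then have "f summable_on range Suc"
      using has_sum_imp_summable summable_on_subset_banach by blast
    then have "(\<lambda>n. f (Suc n)) summable_on UNIV"
      by (subst (asm) summable_on_reindex) (auto simp: o_def)
    then obtain t where t: "((\<lambda>n. f (Suc n)) has_sum t) UNIV"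
      by (auto simp: summable_on_def)
    from has_sum_unique[OF fwd[OF t] *] t show "((\<lambda>n. f (Suc n)) has_sum s) UNIV" by simp
  qed (rule fwd)
qed

text \<open>Moving \<open>m\<close> to \<open>m + 1\<close> puts one new term in front of the series. Starting from \<open>m = 0\<close>, this evaluates
  the row sums in both directions.\<close>
lemma has_sum_row_step:
  "((\<lambda>i. rcp (m - int (Suc i)) ^ 3) has_sum s) UNIV \<longleftrightarrow>
   ((\<lambda>i. rcp (m + 1 - int (Suc i)) ^ 3) has_sum (rcp m ^ 3 + s)) UNIV"
  using has_sum_nat_Suc_iff[of "\<lambda>i. rcp (m + 1 - int (Suc i)) ^ 3" s] by (simp add: algebra_simps)

lemma has_sum_row_neg:
  "((\<lambda>i. rcp (- int n - int (Suc i)) ^ 3) has_sum (gen_harm 3 n - zeta_nat 3)) UNIV"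
proof (induction n)
  case 0
  have "((\<lambda>i. - (inverse (real (Suc i)) ^ 3)) has_sum - zeta_nat 3) UNIV"
    by (intro has_sum_uminusI has_sum_zeta_nat) simp
  then show ?case
  proof (rule has_sum_eqI)
    show "- (inverse (real (Suc i)) ^ 3) = rcp (- int 0 - int (Suc i)) ^ 3" for i
      using rcp_minus[of "int (Suc i)"] by (simp del: of_nat_Suc)
  qed simp
next
  case (Suc n)
  have "- int (Suc n) + 1 = - int n" by simp
  moreover have "rcp (- int (Suc n)) ^ 3 = - (1 / real (Suc n) ^ 3)"
    using rcp_minus[of "int (Suc n)"] by (simp add: divide_inverse power_inverse del: of_nat_Suc)
  ultimately show ?case
    using Suc by (subst has_sum_row_step) (simp add: gen_harm_Suc)
qed

lemma has_sum_row_pos: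
  "((\<lambda>i. rcp (int (Suc n) - int (Suc i)) ^ 3) has_sum (gen_harm 3 n - zeta_nat 3)) UNIV"
proof (induction n)
  case 0
  show ?case
    using has_sum_row_step[of 0 "- zeta_nat 3"] has_sum_row_neg[of 0] by simp
next
  case (Suc n)
  have "((\<lambda>i. rcp (int (Suc n) + 1 - int (Suc i)) ^ 3) has_sum
      (rcp (int (Suc n)) ^ 3 + (gen_harm 3 n - zeta_nat 3))) UNIV"
    using Suc has_sum_row_step by blast
  then show ?case
    by (rule has_sum_eqI) (simp_all add: gen_harm_Suc divide_inverse power_inverse)
qed

lemma has_sum_int_pair:
  fixes f :: "int \<Rightarrow> real"
  assumes "(f has_sum s) UNIV"
  shows "((\<lambda>n. f (int (Suc n)) + f (- int (Suc n))) has_sum (s - f 0)) UNIV"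
proof -
  have "f summable_on range (\<lambda>n. int (Suc n))" "f summable_on range (\<lambda>n. - int (Suc n))"
    using assms has_sum_imp_summable summable_on_subset_banach by blast+
  then have "(\<lambda>n. f (int (Suc n))) summable_on UNIV" "(\<lambda>n. f (- int (Suc n))) summable_on UNIV"
    by (subst (asm) summable_on_reindex; auto simp: o_def inj_on_def)+
  then obtain p q where pq: "((\<lambda>n. f (int (Suc n))) has_sum p) UNIV" "((\<lambda>n. f (- int (Suc n))) has_sum q) UNIV"
    unfolding summable_on_def by blast
  from has_sum_unique[OF has_sum_int_split[OF this] assms] have "p + q = s - f 0" by simp
  with has_sum_add[OF pq] show ?thesis by simp
qed

text \<open>In the coordinates \<open>m\<close> and \<open>l = m - (i + 1)\<close> the array is part of a product of two absolutely summable
  families.\<close>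
lemma summable_double_array:
  "(\<lambda>(m, i). alt_sign m * rcp m ^ 2 * rcp (m - int (Suc i)) ^ 3) summable_on (UNIV \<times> UNIV)"
proof -
  have "(\<lambda>(m, l). \<bar>rcp m\<bar> ^ 2 * \<bar>rcp l\<bar> ^ 3) summable_on (UNIV \<times> UNIV)"
  proof (rule summable_on_SigmaI)
    show "((\<lambda>l. case (m, l) of (m, l) \<Rightarrow> \<bar>rcp m\<bar> ^ 2 * \<bar>rcp l\<bar> ^ 3)
        has_sum \<bar>rcp m\<bar> ^ 2 * infsum (\<lambda>l. \<bar>rcp l\<bar> ^ 3) UNIV) UNIV" for m
      using has_sum_infsum[OF summable_int_power[of 3]] by (auto intro: has_sum_cmult_right)
    show "(\<lambda>m. \<bar>rcp m\<bar> ^ 2 * infsum (\<lambda>l. \<bar>rcp l\<bar> ^ 3) UNIV) summable_on UNIV"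
      by (intro summable_on_cmult_left summable_int_power) simp
  qed auto
  then have "(\<lambda>p. norm (case p of (m, l) \<Rightarrow> alt_sign m * rcp m ^ 2 * rcp l ^ 3)) summable_on (UNIV \<times> UNIV)"
    by (rule summable_on_cong[THEN iffD1, rotated])
       (auto simp: alt_sign_def abs_mult power_abs split: if_splits)
  then have "(\<lambda>(m, l). alt_sign m * rcp m ^ 2 * rcp l ^ 3) summable_on (UNIV \<times> UNIV)"
    by (rule abs_summable_summable)
  then have "(\<lambda>(m, l). alt_sign m * rcp m ^ 2 * rcp l ^ 3) summable_on
      (\<lambda>(m, i). (m, m - int (Suc i))) ` (UNIV \<times> UNIV)"
    by (rule summable_on_subset_banach) auto
  then show ?thesis
    by (subst (asm) summable_on_reindex) (auto simp: inj_on_def o_def case_prod_unfold)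
qed

text \<open>The double array \<open>(-1)\<^sup>m / (m\<^sup>2 (m - j)\<^sup>3)\<close>, with \<open>m \<in> \<int>\<close> and \<open>j \<ge> 1\<close>, is summed in both orders. Summing
  over \<open>m\<close> first gives zeta values. Summing over \<open>j\<close> first gives a tail of \<open>\<zeta>(3)\<close>, and the rows \<open>m\<close> and \<open>-m\<close> with \<open>m \<ge> 1\<close>
  together carry \<open>H\<^sub>m\<^sub>-\<^sub>1 + H\<^sub>m - 2 \<zeta>(3)\<close> with harmonic numbers of order 3: the Euler sum, up to a product
  of zeta values.\<close>
lemma alternating_euler_sum:
  "((\<lambda>k. (-1) ^ k / real (Suc k) ^ 2 * (gen_harm 3 k + gen_harm 3 (Suc k))) has_sum
     (3 / 2 * zeta_nat 2 * zeta_nat 3 - 9 / 4 * zeta_nat 5)) UNIV"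
proof -
  define D where "D = (\<lambda>(m, i). alt_sign m * rcp m ^ 2 * rcp (m - int (Suc i)) ^ 3)"
  define V where "V = infsum D (UNIV \<times> UNIV)"
  have D: "(D has_sum V) (UNIV \<times> UNIV)"
    unfolding V_def using summable_double_array by (intro has_sum_infsum) (simp add: D_def)
  define col where "col i = 6 * inverse (real (Suc i)) ^ 5
      + 4 * (alt_sign (int (Suc i)) * inverse (real (Suc i)) ^ 5)
      + zeta_nat 2 * inverse (real (Suc i)) ^ 3
      + 2 * zeta_nat 2 * (alt_sign (int (Suc i)) * inverse (real (Suc i)) ^ 3)" for i
  have "(col has_sum V) UNIV"
  proof (rule has_sum_SigmaD)
    show "((\<lambda>(i, m). D (m, i)) has_sum V) (UNIV \<times> UNIV)"
      using D by (subst (asm) has_sum_swap)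
    show "((\<lambda>m. case (i, m) of (i, m) \<Rightarrow> D (m, i)) has_sum col i) UNIV" for i
      using alternating_column_sum[of "Suc i"] by (simp only: D_def col_def prod.case zero_less_Suc)
  qed
  moreover have "(col has_sum 6 * zeta_nat 5 + 4 * ((2 / 2 ^ 5 - 1) * zeta_nat 5)
      + zeta_nat 2 * zeta_nat 3 + 2 * zeta_nat 2 * ((2 / 2 ^ 3 - 1) * zeta_nat 3)) UNIV"
    unfolding col_def
    by (intro has_sum_add has_sum_cmult_right has_sum_zeta_nat has_sum_eta_nat) simp_all
  ultimately have V: "V = 9 / 4 * zeta_nat 5 - 1 / 2 * zeta_nat 2 * zeta_nat 3"
    using has_sum_unique by fastforce
  define row where "row m = alt_sign m * rcp m ^ 2 *
      (if m > 0 then gen_harm 3 (nat m - 1) - zeta_nat 3 else gen_harm 3 (nat (- m)) - zeta_nat 3)" for m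
  have "(row has_sum V) UNIV"
  proof (rule has_sum_SigmaD[OF D])
    fix m :: int
    have "((\<lambda>i. rcp (m - int (Suc i)) ^ 3) has_sum
      (if m > 0 then gen_harm 3 (nat m - 1) - zeta_nat 3 else gen_harm 3 (nat (- m)) - zeta_nat 3)) UNIV"
    proof (cases "m > 0")
      case True
      then have "int (Suc (nat m - 1)) = m" by simp
      with has_sum_row_pos[of "nat m - 1"] True show ?thesis by simp
    next
      case False
      then have "- int (nat (- m)) = m" by simp
      with has_sum_row_neg[of "nat (- m)"] False show ?thesis by (simp only: if_False)
    qed
    then show "((\<lambda>i. D (m, i)) has_sum row m) UNIV"
      unfolding D_def row_def prod.case by (rule has_sum_cmult_right)
  qed
  from has_sum_int_pair[OF this]
  have "((\<lambda>n. row (int (Suc n)) + row (- int (Suc n))) has_sum V) UNIV"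
    by (simp add: row_def)
  moreover have "row (int (Suc n)) + row (- int (Suc n)) = alt_sign (int (Suc n)) * inverse (real (Suc n)) ^ 2
      * (gen_harm 3 n + gen_harm 3 (Suc n) - 2 * zeta_nat 3)" for n
  proof -
    have "row (- int (Suc n)) = alt_sign (int (Suc n)) * inverse (real (Suc n)) ^ 2 * (gen_harm 3 (Suc n) - zeta_nat 3)"
      unfolding row_def rcp_minus power_minus_even[OF even_numeral] minus_minus nat_int by (simp add: alt_sign_def)
    moreover have "row (int (Suc n)) = alt_sign (int (Suc n)) * inverse (real (Suc n)) ^ 2 * (gen_harm 3 n - zeta_nat 3)"
      by (simp add: row_def del: of_nat_Suc)
    ultimately show ?thesis by (simp add: algebra_simps)
  qed
  ultimately have "((\<lambda>n. alt_sign (int (Suc n)) * inverse (real (Suc n)) ^ 2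
      * (gen_harm 3 n + gen_harm 3 (Suc n) - 2 * zeta_nat 3)) has_sum V) UNIV"
    by simp
  moreover have "((\<lambda>n. 2 * zeta_nat 3 * (alt_sign (int (Suc n)) * inverse (real (Suc n)) ^ 2))
      has_sum (2 * zeta_nat 3 * ((2 / 2 ^ 2 - 1) * zeta_nat 2))) UNIV"
    by (intro has_sum_cmult_right has_sum_eta_nat) simp
  ultimately have "((\<lambda>n. - (alt_sign (int (Suc n)) * inverse (real (Suc n)) ^ 2
      * (gen_harm 3 n + gen_harm 3 (Suc n) - 2 * zeta_nat 3)
      + 2 * zeta_nat 3 * (alt_sign (int (Suc n)) * inverse (real (Suc n)) ^ 2)))
      has_sum - (V + 2 * zeta_nat 3 * ((2 / 2 ^ 2 - 1) * zeta_nat 2))) UNIV"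
    by (intro has_sum_uminusI has_sum_add)
  then show ?thesis
  proof (rule has_sum_eqI)
    fix k :: nat
    have "(-1) ^ k / real (Suc k) ^ 2 = - alt_sign (int (Suc k)) * inverse (real (Suc k)) ^ 2"
      by (simp add: alt_sign_def divide_inverse power_inverse)
    then show "- (alt_sign (int (Suc k)) * inverse (real (Suc k)) ^ 2
      * (gen_harm 3 k + gen_harm 3 (Suc k) - 2 * zeta_nat 3)
      + 2 * zeta_nat 3 * (alt_sign (int (Suc k)) * inverse (real (Suc k)) ^ 2))
      = (-1) ^ k / real (Suc k) ^ 2 * (gen_harm 3 k + gen_harm 3 (Suc k))"
      by (simp only:) (simp add: algebra_simps)
  qed (simp add: V)
qed

lemma zeta_nat_2: "zeta_nat 2 = pi\<^sup>2 / 6"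
  using inverse_squares_sums by (simp add: zeta_nat_def sums_iff add_ac)

lemma zeta_numeral:
  assumes "numeral r \<ge> (2 :: nat)"
  shows "zeta (numeral r) = complex_of_real (zeta_nat (numeral r))"
proof -
  have "summable (\<lambda>n. 1 / real (Suc n) ^ numeral r)"
    using has_sum_imp_sums[OF has_sum_zeta_nat[OF assms]]
    by (simp add: sums_iff divide_inverse power_inverse)
  then have "complex_of_real (zeta_nat (numeral r)) = (\<Sum>n. complex_of_real (1 / real (Suc n) ^ numeral r))"
    unfolding zeta_nat_def by (rule suminf_of_real)
  also have "\<dots> = zeta (numeral r)"
    unfolding zeta_def
    by (intro suminf_cong) (simp add: powr_minus divide_inverse del: of_nat_Suc)
  finally show ?thesis ..
qed

section \<open>Evaluation of the series\<close>

theorem theorem1p3: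
  shows "(\<lambda>k::nat. complex_of_real
           ((1/64) ^ k * (pochhammer 1 k ^ 3 / pochhammer (3/2) k ^ 3) *
            ((21 * real k + 13) * (gen_harm 3 (2*k+1) + 2 * gen_harm 3 k)
             - 27 / (8 * (real k + 1) ^ 2))))
         sums (4 * complex_of_real pi ^ 2 * zeta 3 - 36 * zeta 5)"
proof -
  define E where "E = 3 / 2 * zeta_nat 2 * zeta_nat 3 - 9 / 4 * zeta_nat 5"
  have "wz_G 0 sums (2 * E)"
    using sums_mult[OF has_sum_imp_sums[OF alternating_euler_sum], of 2]
    unfolding wz_G_0[symmetric] E_def[symmetric] .
  then have "(\<lambda>k. 8 * wz_F k 0) sums (8 * (2 * E))"
    by (intro sums_mult wz_sums_transfer)
  then have "(\<lambda>k. complex_of_real (8 * wz_F k 0)) sums complex_of_real (8 * (2 * E))"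
    by (subst sums_of_real_iff)
  moreover have "complex_of_real (8 * (2 * E)) = 4 * complex_of_real pi ^ 2 * zeta 3 - 36 * zeta 5"
    by (simp add: zeta_numeral E_def zeta_nat_2)
  ultimately show ?thesis
    unfolding wz_F_0 by simp
qed

end
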